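(* Let $\mathscr{H}$ be a complex Hilbert space and let $A$ be a bounded linear operator on $\mathscr{H}$. Then $$\frac{1}{4} \|A^*A+AA^*\|+\frac{1}{2}\max \{\|\Re(A)\|,\|\Im(A)\|\}\,\big| \|\Re(A)+\Im(A)\|-\|\Re(A)-\Im(A)\|\big| \;\leq\; w^2(A) \;\leq\; w^2\big( |\Re(A)| +i |\Im(A)|\big).$$
   Context: For a bounded linear operator $A$ on a complex Hilbert space $\mathscr{H}$ with inner product $\langle\cdot,\cdot\rangle$: $A^*$ is the adjoint, $\|A\|$ is the operator norm, $|A|=(A^*A)^{1/2}$ is the positive square root, $\Re(A)=\frac12(A+A^* )$ and $\Im(A)=\frac{1}{2i}(A-A^* )$. The numerical radius is $w(A)=\sup\{|\langle Ax,x\rangle| : x\in\mathscr{H}, \|x\|=1\}$, and $w^2(A)$ denotes $(w(A))^2$. *)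

theory Defs
  imports "HOL-Analysis.Analysis"
begin

class complex_vector = real_vector +
  fixes scaleC :: "complex \<Rightarrow> 'a \<Rightarrow> 'a" (infixr "*\<^sub>C" 75)
  assumes scaleC_add_right: "a *\<^sub>C (x + y) = a *\<^sub>C x + a *\<^sub>C y"
    and scaleC_add_left: "(a + b) *\<^sub>C x = a *\<^sub>C x + b *\<^sub>C x"
    and scaleC_scaleC: "a *\<^sub>C (b *\<^sub>C x) = (a * b) *\<^sub>C x"
    and scaleC_one: "1 *\<^sub>C x = x"
    and scaleR_scaleC: "r *\<^sub>R x = complex_of_real r *\<^sub>C x"

text \<open>The inner product is linear in its first argument and conjugate-linear in its second.\<close>

class complex_inner = complex_vector + real_normed_vector +
  fixes cinner :: "'a \<Rightarrow> 'a \<Rightarrow> complex"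
  assumes cinner_commute: "cinner x y = cnj (cinner y x)"
    and cinner_add_left: "cinner (x + y) z = cinner x z + cinner y z"
    and cinner_scaleC_left: "cinner (c *\<^sub>C x) y = c * cinner x y"
    and cinner_self_nonneg: "cinner x x \<in> \<real>\<^sub>\<ge>\<^sub>0"
    and cinner_eq_zero_iff: "cinner x x = 0 \<longleftrightarrow> x = 0"
    and norm_eq_sqrt_cinner: "norm x = sqrt (Re (cinner x x))"

class chilbert_space = complex_inner + complete_space

instantiation complex :: chilbert_space
begin

definition scaleC_complex :: "complex \<Rightarrow> complex \<Rightarrow> complex"
  where "scaleC_complex c z = c * z"

definition cinner_complex :: "complex \<Rightarrow> complex \<Rightarrow> complex"
  where "cinner_complex z u = z * cnj u"

instance
proof
  fix x :: complex
  show "cinner x x \<in> \<real>\<^sub>\<ge>\<^sub>0"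
    by (simp add: cinner_complex_def complex_nonneg_Reals_iff)
  show "norm x = sqrt (Re (cinner x x))"
    by (simp add: cinner_complex_def cmod_def power2_eq_square)
qed (auto simp: scaleC_complex_def cinner_complex_def algebra_simps scaleR_conv_of_real)

end

definition bounded_clinear :: "('a::complex_inner \<Rightarrow> 'b::complex_inner) \<Rightarrow> bool"
  where "bounded_clinear A \<longleftrightarrow> bounded_linear A \<and> (\<forall>c x. A (c *\<^sub>C x) = c *\<^sub>C A x)"

text \<open>
  For bounded linear operators on a Hilbert space the two definite descriptions below denote:
  the adjoint exists by the Riesz representation theorem, and a positive operator has a unique
  positive square root.
\<close>

definition cadjoint :: "('a::chilbert_space \<Rightarrow> 'a) \<Rightarrow> 'a \<Rightarrow> 'a"
  where "cadjoint A = (THE B. \<forall>x y. cinner (A x) y = cinner x (B y))"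

definition positive_op :: "('a::chilbert_space \<Rightarrow> 'a) \<Rightarrow> bool"
  where "positive_op A \<longleftrightarrow> bounded_clinear A \<and> (\<forall>x. cinner (A x) x \<in> \<real>\<^sub>\<ge>\<^sub>0)"

definition sqrt_op :: "('a::chilbert_space \<Rightarrow> 'a) \<Rightarrow> 'a \<Rightarrow> 'a"
  where "sqrt_op A = (THE B. positive_op B \<and> B \<circ> B = A)"

definition abs_op :: "('a::chilbert_space \<Rightarrow> 'a) \<Rightarrow> 'a \<Rightarrow> 'a"
  where "abs_op A = sqrt_op (cadjoint A \<circ> A)"

definition Re_op :: "('a::chilbert_space \<Rightarrow> 'a) \<Rightarrow> 'a \<Rightarrow> 'a"
  where "Re_op A = (\<lambda>x. (1 / 2) *\<^sub>C (A x + cadjoint A x))"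

definition Im_op :: "('a::chilbert_space \<Rightarrow> 'a) \<Rightarrow> 'a \<Rightarrow> 'a"
  where "Im_op A = (\<lambda>x. (1 / (2 * \<i>)) *\<^sub>C (A x - cadjoint A x))"

text \<open>On the zero space the supremum is taken over the empty set and is the fixed but
  unspecified real \<open>Sup {}\<close>, independent of the operator.\<close>

definition numerical_radius :: "('a::chilbert_space \<Rightarrow> 'a) \<Rightarrow> real"
  where "numerical_radius A = (SUP x\<in>{x. norm x = 1}. cmod (cinner (A x) x))"

end

theory Submission imports Defs begin

text \<open>Write \<open>A = B + i C\<close> with \<open>B = Re A\<close>, \<open>C = Im A\<close> Hermitian, and put \<open>P = B + C\<close>,
  \<open>Q = B - C\<close>. Then \<open>A\<^sup>* A + A A\<^sup>* = P\<^sup>2 + Q\<^sup>2\<close>, while \<open>B\<close> and \<open>C\<close> have norm at most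
  \<open>(\<parallel>P\<parallel> + \<parallel>Q\<parallel>) / 2\<close>, so the left-hand side is at most \<open>max \<parallel>P\<parallel>\<^sup>2 \<parallel>Q\<parallel>\<^sup>2 / 2\<close>. The norm of a
  Hermitian operator is its numerical radius, and \<open>(b \<plusminus> c)\<^sup>2 \<le> 2 (b\<^sup>2 + c\<^sup>2)\<close> for the quadratic forms
  \<open>b, c\<close> of \<open>B, C\<close> bounds this by \<open>w(A)\<^sup>2\<close>. The second inequality comes from
  \<open>|\<langle>Ax, x\<rangle>|\<^sup>2 = b\<^sup>2 + c\<^sup>2\<close> and \<open>|\<langle>Bx, x\<rangle>| \<le> \<langle>|B|x, x\<rangle>\<close>.\<close>

section \<open>Inner products\<close>

lemma scaleC_zero_right [simp]: "c *\<^sub>C 0 = (0 :: 'a::complex_vector)"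
  using scaleC_add_right[of c 0 0] by simp

lemma scaleC_minus_one: "(-1) *\<^sub>C x = - (x :: 'a::complex_vector)"
  using scaleR_scaleC[of "-1" x] by simp

lemma scaleC_minus_right: "c *\<^sub>C (- x) = - (c *\<^sub>C x :: 'a::complex_vector)"
  using scaleC_add_right[of c x "- x"] by (simp add: eq_neg_iff_add_eq_0 add.commute)

lemma scaleC_diff_right: "c *\<^sub>C (x - y) = c *\<^sub>C x - c *\<^sub>C (y :: 'a::complex_vector)"
  using scaleC_add_right[of c x "- y"] by (simp add: scaleC_minus_right)

lemma scaleC_scaleR: "c *\<^sub>C (r *\<^sub>R x) = r *\<^sub>R (c *\<^sub>C (x :: 'a::complex_vector))"
  by (simp add: scaleR_scaleC scaleC_scaleC mult.commute)

lemma cinner_add_right: "cinner x (y + z) = cinner x y + cinner x z"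
  by (metis cinner_add_left cinner_commute complex_cnj_add)

lemma cinner_scaleC_right: "cinner x (c *\<^sub>C y) = cnj c * cinner x y"
  by (metis cinner_scaleC_left cinner_commute complex_cnj_mult)

lemma cinner_scaleR_left: "cinner (r *\<^sub>R x) y = of_real r * cinner x y"
  by (simp add: scaleR_scaleC cinner_scaleC_left)

lemma cinner_scaleR_right: "cinner x (r *\<^sub>R y) = of_real r * cinner x y"
  by (simp add: scaleR_scaleC cinner_scaleC_right)

lemma cinner_minus_left: "cinner (- x) y = - cinner x y"
  using cinner_scaleR_left[of "-1" x y] by simp

lemma cinner_minus_right: "cinner x (- y) = - cinner x y"
  using cinner_scaleR_right[of x "-1" y] by simp

lemma cinner_diff_left: "cinner (x - y) z = cinner x z - cinner y z"
  using cinner_add_left[of x "- y" z] by (simp add: cinner_minus_left)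

lemma cinner_diff_right: "cinner x (y - z) = cinner x y - cinner x z"
  using cinner_add_right[of x y "- z"] by (simp add: cinner_minus_right)

lemma cinner_zero_left [simp]: "cinner 0 y = 0"
  using cinner_scaleR_left[of 0 0 y] by simp

lemma cinner_zero_right [simp]: "cinner y 0 = 0"
  using cinner_scaleR_right[of y 0 0] by simp

lemmas cinner_simps = cinner_add_left cinner_add_right cinner_diff_left cinner_diff_right
  cinner_scaleR_left cinner_scaleR_right cinner_scaleC_left cinner_scaleC_right
  cinner_minus_left cinner_minus_right

lemma Re_cinner_commute: "Re (cinner x y) = Re (cinner y x)"
  by (metis cinner_commute complex_cnj(1) complex.collapse complex.sel(1))

lemma power2_norm_eq_cinner: "(norm x)\<^sup>2 = Re (cinner x x)"
  using cinner_self_nonneg[of x] by (simp add: norm_eq_sqrt_cinner complex_nonneg_Reals_iff)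

lemma cinner_self: "cinner x x = of_real ((norm x)\<^sup>2)"
  using cinner_self_nonneg[of x]
  by (simp add: power2_norm_eq_cinner complex_nonneg_Reals_iff complex_eq_iff del: of_real_power)

lemma power2_norm_add: "(norm (x + y))\<^sup>2 = (norm x)\<^sup>2 + 2 * Re (cinner x y) + (norm y)\<^sup>2"
  for x y :: "'a::complex_inner"
  using Re_cinner_commute[of x y] by (simp add: power2_norm_eq_cinner cinner_simps)

lemma parallelogram_law:
  "(norm (x + y))\<^sup>2 + (norm (x - y))\<^sup>2 = 2 * (norm x)\<^sup>2 + 2 * (norm (y :: 'a::complex_inner))\<^sup>2"
  by (simp add: power2_norm_eq_cinner cinner_simps)

lemma norm_scaleC: "norm (c *\<^sub>C x) = cmod c * norm (x :: 'a::complex_inner)"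
proof (rule power2_eq_imp_eq)
  have "cinner (c *\<^sub>C x) (c *\<^sub>C x) = of_real ((cmod c)\<^sup>2 * (norm x)\<^sup>2)"
    by (simp add: cinner_simps cinner_self[of x] complex_norm_square mult.assoc del: of_real_power)
  then show "(norm (c *\<^sub>C x))\<^sup>2 = (cmod c * norm x)\<^sup>2"
    by (simp only: power2_norm_eq_cinner[of "c *\<^sub>C x"] Re_complex_of_real power_mult_distrib)
qed simp_all

text \<open>The triangle inequality is already an axiom of the normed space, so Cauchy-Schwarz is
  obtained by squaring it.\<close>

lemma Re_cinner_le: "Re (cinner x y) \<le> norm x * norm (y :: 'a::complex_inner)"
proof -
  have "(norm (x + y))\<^sup>2 \<le> (norm x + norm y)\<^sup>2"
    by (intro power_mono norm_triangle_ineq) simp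
  then show ?thesis by (simp add: power2_norm_add power2_sum)
qed

lemma norm_cinner_le: "cmod (cinner x y) \<le> norm x * norm (y :: 'a::complex_inner)"
proof (cases "cinner x y = 0")
  case False
  \<comment> \<open>A unimodular factor that rotates the inner product onto the nonnegative
    reals.\<close>
  define u where "u = cnj (sgn (cinner x y))"
  have "cmod u = 1" using False by (simp add: u_def norm_sgn)
  moreover have "u * cinner x y = of_real (cmod (cinner x y))"
    using False complex_norm_square[of "cinner x y"]
    by (simp add: u_def sgn_eq field_simps power2_eq_square)
  ultimately show ?thesis
    using Re_cinner_le[of "u *\<^sub>C x" y] by (simp add: cinner_simps norm_scaleC)
qed simp

lemma cinner_ext: "(\<And>z. cinner z x = cinner z y) \<Longrightarrow> x = y"
  by (metis cinner_diff_right cinner_eq_zero_iff right_minus_eq)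

lemma bounded_linear_scaleC: "bounded_linear (\<lambda>x :: 'a::complex_inner. c *\<^sub>C x)"
  by (rule bounded_linear_intro[where K = "cmod c"])
    (auto simp: scaleC_add_right scaleC_scaleR norm_scaleC)

lemma bounded_linear_cinner_left: "bounded_linear (\<lambda>x. cinner x y)"
  by (rule bounded_linear_intro[where K = "norm y"])
    (auto simp: cinner_simps norm_cinner_le scaleR_conv_of_real)

lemma bounded_linear_cinner_right: "bounded_linear (\<lambda>x. cinner y x)"
  by (rule bounded_linear_intro[where K = "norm y"])
    (auto simp: cinner_simps scaleR_conv_of_real, metis norm_cinner_le mult.commute)

section \<open>The adjoint\<close>

text \<open>First-order condition: a quadratic polynomial that vanishes at 0 and is minimal there
  has no linear term. It serves the Riesz argument and the kernel of a positive operator.\<close>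

lemma linear_coeff_eq_0:
  fixes a b :: real
  assumes "\<And>t. 0 \<le> t * a + t\<^sup>2 * b"
  shows "a = 0"
proof (rule ccontr)
  assume a: "a \<noteq> 0"
  \<comment> \<open>Any positive \<open>c\<close> above \<open>b\<close> makes the value at
    \<open>t = - a / c\<close> negative.\<close>
  define c where "c = \<bar>b\<bar> + 1"
  have c: "c > 0" "b < c" by (auto simp: c_def)
  have "(- a / c) * a + (- a / c)\<^sup>2 * b = a\<^sup>2 / c\<^sup>2 * (b - c)"
    using c by (simp add: field_simps power2_eq_square)
  also have "\<dots> < 0" using a c by (intro mult_pos_neg) auto
  finally show False using assms[of "- a / c"] by simp
qed

text \<open>The representing vector is the minimizer of \<open>\<parallel>x\<parallel>\<^sup>2 - 2 Re (f x)\<close>; the parallelogram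
  law makes every minimizing sequence Cauchy.\<close>

lemma riesz_representation:
  fixes f :: "'a::chilbert_space \<Rightarrow> complex"
  assumes f: "bounded_linear f" and fC: "\<And>c x. f (c *\<^sub>C x) = c * f x"
  shows "\<exists>z. \<forall>x. f x = cinner x z"
proof -
  interpret f: bounded_linear f by fact
  define J where "J x = (norm x)\<^sup>2 - 2 * Re (f x)" for x
  have J_ge: "J x \<ge> - (onorm f)\<^sup>2" for x
  proof -
    have "Re (f x) \<le> onorm f * norm x"
      using complex_Re_le_cmod[of "f x"] onorm[OF f, of x] by linarith
    moreover have "0 \<le> (norm x - onorm f)\<^sup>2" by simp
    ultimately show ?thesis by (simp add: J_def power2_diff algebra_simps)
  qed
  then have bdd: "bdd_below (range J)" by (metis bdd_belowI2)
  define m where "m = (INF x. J x)"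
  have m_le: "m \<le> J x" for x unfolding m_def by (rule cINF_lower[OF bdd]) simp
  have "\<exists>x. J x < m + 1 / real (Suc n)" for n
    using cINF_less_iff[OF _ bdd, of "m + 1 / real (Suc n)"] unfolding m_def by auto
  then obtain X where X: "\<And>n. J (X n) < m + 1 / real (Suc n)" by metis
  \<comment> \<open>At the midpoint \<open>J\<close> is still at least \<open>m\<close>; the
    parallelogram law turns this into a bound on the distance.\<close>
  have dist: "(norm (x - y))\<^sup>2 \<le> 2 * (J x - m) + 2 * (J y - m)" for x y
  proof -
    have "(norm ((1/2) *\<^sub>R (x + y)))\<^sup>2 = (norm (x + y))\<^sup>2 / 4" by (simp add: power_divide)
    then have "J ((1/2) *\<^sub>R (x + y)) = (norm (x + y))\<^sup>2 / 4 - Re (f x) - Re (f y)"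
      by (simp add: J_def f.scaleR f.add add_divide_distrib power_divide)
    then show ?thesis
      using m_le[of "(1/2) *\<^sub>R (x + y)"] parallelogram_law[of x y] by (simp add: J_def)
  qed
  have "Cauchy X"
  proof (rule metric_CauchyI)
    fix e :: real assume e: "e > 0"
    obtain N where N: "1 / real (Suc N) < e\<^sup>2 / 4"
      using e by (metis nat_approx_posE zero_less_divide_iff zero_less_numeral zero_less_power)
    have *: "J (X n) - m < e\<^sup>2 / 4" if "n \<ge> N" for n
    proof -
      have "1 / real (Suc n) \<le> 1 / real (Suc N)" using that by (simp add: field_simps)
      then show ?thesis using X[of n] N by linarith
    qed
    have "dist (X k) (X n) < e" if "k \<ge> N" "n \<ge> N" for k n
    proof (rule power2_less_imp_less)
      show "(dist (X k) (X n))\<^sup>2 < e\<^sup>2"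
        using dist[of "X k" "X n"] *[OF that(1)] *[OF that(2)] by (simp add: dist_norm)
    qed (use e in simp)
    then show "\<exists>N. \<forall>k\<ge>N. \<forall>n\<ge>N. dist (X k) (X n) < e" by blast
  qed
  then obtain z where z: "X \<longlonglongrightarrow> z" using Cauchy_convergent convergent_def by blast
  have "(\<lambda>n. J (X n)) \<longlonglongrightarrow> J z"
    unfolding J_def by (intro tendsto_intros z f.tendsto)
  moreover have "(\<lambda>n. m + 1 / real (Suc n)) \<longlonglongrightarrow> m + 0"
    by (intro tendsto_intros LIMSEQ_Suc lim_1_over_n)
  ultimately have "J z \<le> m + 0"
    by (rule LIMSEQ_le) (use X in \<open>auto intro: less_imp_le\<close>)
  then have z_le: "J z \<le> J x" for x using m_le[of x] by simp
  \<comment> \<open>First variation of \<open>J\<close> at its minimizer \<open>z\<close> in the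
    direction \<open>x\<close>.\<close>
  have Re_eq: "Re (f x) = Re (cinner x z)" for x
  proof -
    have "0 \<le> t * (2 * Re (cinner x z) - 2 * Re (f x)) + t\<^sup>2 * (norm x)\<^sup>2" for t
      using z_le[of "t *\<^sub>R x + z"] Re_cinner_commute[of z x]
      by (simp add: J_def power2_norm_add f.add f.scaleR cinner_simps power_mult_distrib algebra_simps)
    then show ?thesis using linear_coeff_eq_0 by fastforce
  qed
  \<comment> \<open>Up to sign, the imaginary parts are the real parts at
    \<open>\<i> *\<^sub>C x\<close>.\<close>
  have "f x = cinner x z" for x
    using Re_eq[of x] Re_eq[of "\<i> *\<^sub>C x"] by (simp add: fC cinner_simps complex_eq_iff)
  then show ?thesis by blast
qed

section \<open>Bounded complex-linear operators and their adjoints\<close>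

lemma bounded_clinearI:
  "bounded_linear A \<Longrightarrow> (\<And>c x. A (c *\<^sub>C x) = c *\<^sub>C A x) \<Longrightarrow> bounded_clinear A"
  by (simp add: bounded_clinear_def)

lemma bounded_clinear_imp_bounded_linear: "bounded_clinear A \<Longrightarrow> bounded_linear A"
  by (simp add: bounded_clinear_def)

lemma bounded_clinear_scaleC: "bounded_clinear A \<Longrightarrow> A (c *\<^sub>C x) = c *\<^sub>C A x"
  by (simp add: bounded_clinear_def)

lemma bounded_clinear_add:
  "bounded_clinear A \<Longrightarrow> bounded_clinear B \<Longrightarrow> bounded_clinear (\<lambda>x. A x + B x)"
  by (simp add: bounded_clinear_def bounded_linear_add scaleC_add_right)

lemma bounded_clinear_sub:
  "bounded_clinear A \<Longrightarrow> bounded_clinear B \<Longrightarrow> bounded_clinear (\<lambda>x. A x - B x)"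
  by (simp add: bounded_clinear_def bounded_linear_sub scaleC_diff_right)

lemma bounded_clinear_const_scaleC:
  "bounded_clinear A \<Longrightarrow> bounded_clinear (\<lambda>x. c *\<^sub>C A x)"
  using bounded_linear_compose[OF bounded_linear_scaleC, of A c]
  by (simp add: bounded_clinear_def scaleC_scaleC mult.commute)

lemma bounded_clinear_const_scaleR:
  "bounded_clinear A \<Longrightarrow> bounded_clinear (\<lambda>x. r *\<^sub>R A x)"
  by (simp add: scaleR_scaleC bounded_clinear_const_scaleC)

lemma bounded_clinear_comp:
  "bounded_clinear A \<Longrightarrow> bounded_clinear B \<Longrightarrow> bounded_clinear (A \<circ> B)"
  using bounded_linear_compose[of A B] by (simp add: bounded_clinear_def o_def)

lemma bounded_clinear_id: "bounded_clinear (\<lambda>x. x)"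
  by (simp add: bounded_clinear_def bounded_linear_ident)

lemma cadjoint_eqI:
  assumes "\<And>x y. cinner (A x) y = cinner x (B y)"
  shows "cadjoint A = B"
  unfolding cadjoint_def
proof (rule the_equality)
  fix C assume "\<forall>x y. cinner (A x) y = cinner x (C y)"
  then have "cinner x (C y) = cinner x (B y)" for x y using assms by metis
  then show "C = B" by (intro ext) (rule cinner_ext)
qed (use assms in blast)

text \<open>For each \<open>y\<close>, Riesz represents the functional mapping \<open>x\<close> to
  \<open>cinner (A x) y\<close>, so the definite description in \<open>cadjoint\<close>
  denotes.\<close>

lemma cinner_cadjoint:
  assumes A: "bounded_clinear A"
  shows "cinner (A x) y = cinner x (cadjoint A y)"
proof -
  have "\<exists>z. \<forall>x. cinner (A x) y = cinner x z" for y
    using A bounded_linear_compose[OF bounded_linear_cinner_left bounded_clinear_imp_bounded_linear]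
    by (intro riesz_representation) (auto simp: bounded_clinear_scaleC cinner_simps)
  then obtain B where B: "\<And>x y. cinner (A x) y = cinner x (B y)" by metis
  then show ?thesis using cadjoint_eqI[of A B] by metis
qed

lemma bounded_clinear_cadjoint:
  assumes A: "bounded_clinear A"
  shows "bounded_clinear (cadjoint A)"
proof -
  note adj = cinner_cadjoint[OF A, symmetric]
  have bl: "bounded_linear A" using A by (rule bounded_clinear_imp_bounded_linear)
  show ?thesis
  proof (intro bounded_clinearI bounded_linear_intro[where K = "onorm A"])
    fix y
    \<comment> \<open>Estimating the square and cancelling one factor leaves the bound
      \<open>onorm A\<close>.\<close>
    have "norm (cadjoint A y) * norm (cadjoint A y) = cmod (cinner (A (cadjoint A y)) y)"
      by (simp add: cinner_cadjoint[OF A] cinner_self power2_eq_square norm_mult)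
    also have "\<dots> \<le> norm (A (cadjoint A y)) * norm y" by (rule norm_cinner_le)
    also have "\<dots> \<le> (onorm A * norm (cadjoint A y)) * norm y"
      by (intro mult_right_mono onorm bl) simp
    finally have "norm (cadjoint A y) * norm (cadjoint A y)
      \<le> norm (cadjoint A y) * (norm y * onorm A)" by (simp add: algebra_simps)
    then show "norm (cadjoint A y) \<le> norm y * onorm A"
      by (cases "cadjoint A y = 0") (auto simp: onorm_pos_le[OF bl])
  next
    fix x y and r :: real and c
    show "cadjoint A (x + y) = cadjoint A x + cadjoint A y"
      by (rule cinner_ext) (simp add: adj cinner_simps)
    show "cadjoint A (r *\<^sub>R x) = r *\<^sub>R cadjoint A x"
      by (rule cinner_ext) (simp add: adj cinner_simps)
    show "cadjoint A (c *\<^sub>C x) = c *\<^sub>C cadjoint A x"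
      by (rule cinner_ext) (simp add: adj cinner_simps)
  qed
qed

section \<open>Hermitian and positive operators\<close>

text \<open>Symmetry is stated through the inner product, so closure properties follow without the
  definite description in \<open>cadjoint\<close>.\<close>

definition hermitian :: "('a::chilbert_space \<Rightarrow> 'a) \<Rightarrow> bool"
  where "hermitian A \<longleftrightarrow> bounded_clinear A \<and> (\<forall>x y. cinner (A x) y = cinner x (A y))"

lemma hermitianD:
  assumes "hermitian A"
  shows "bounded_clinear A" "bounded_linear A" "cinner (A x) y = cinner x (A y)"
  using assms by (auto simp: hermitian_def bounded_clinear_def)

lemma hermitian_cadjoint: "hermitian A \<Longrightarrow> cadjoint A = A"
  by (auto simp: hermitian_def intro: cadjoint_eqI)

lemma hermitian_add: "hermitian A \<Longrightarrow> hermitian B \<Longrightarrow> hermitian (\<lambda>x. A x + B x)"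
  by (simp add: hermitian_def bounded_clinear_add cinner_simps)

lemma hermitian_sub: "hermitian A \<Longrightarrow> hermitian B \<Longrightarrow> hermitian (\<lambda>x. A x - B x)"
  by (simp add: hermitian_def bounded_clinear_sub cinner_simps)

lemma hermitian_scaleR: "hermitian A \<Longrightarrow> hermitian (\<lambda>x. r *\<^sub>R A x)"
  by (simp add: hermitian_def bounded_clinear_const_scaleR cinner_simps)

lemma hermitian_id: "hermitian (\<lambda>x. x)"
  by (simp add: hermitian_def bounded_clinear_id)

lemma hermitian_square: "hermitian A \<Longrightarrow> hermitian (A \<circ> A)"
  by (simp add: hermitian_def bounded_clinear_comp)

lemma hermitian_cinner_real:
  assumes "hermitian A"
  shows "cinner (A x) x = of_real (Re (cinner (A x) x))"
proof -
  have "cinner (A x) x = cnj (cinner (A x) x)"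
    using cinner_commute[of "A x" x] hermitianD(3)[OF assms, of x x] by simp
  then show ?thesis by (simp add: complex_eq_iff)
qed

lemma hermitian_Re_cinner_commute:
  "hermitian A \<Longrightarrow> Re (cinner (A x) y) = Re (cinner (A y) x)"
  using Re_cinner_commute[of "A y" x] hermitianD(3)[of A x y] by simp

text \<open>Polarization: the quadratic form of a Hermitian operator controls its norm.\<close>

lemma hermitian_norm_le:
  fixes A :: "'a::chilbert_space \<Rightarrow> 'a"
  assumes A: "hermitian A" and c: "\<And>x. \<bar>Re (cinner (A x) x)\<bar> \<le> c * (norm x)\<^sup>2"
  shows "norm (A x) \<le> c * norm x"
proof (cases "A x = 0 \<or> x = 0")
  case True
  moreover have "0 \<le> c * norm x"
    using order_trans[OF abs_ge_zero c[of x]] by (auto simp: zero_le_mult_iff)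
  ultimately show ?thesis using linear_0[OF bounded_linear.linear[OF hermitianD(2)[OF A]]] by auto
next
  case False
  interpret A: bounded_linear A by (rule hermitianD(2)[OF A])
  \<comment> \<open>\<open>A x\<close> is rescaled to the length of \<open>x\<close>: the inner
    product becomes \<open>norm x * norm (A x)\<close>, and the parallelogram law gives
    \<open>4 * (norm x)\<^sup>2\<close>.\<close>
  define y where "y = (norm x / norm (A x)) *\<^sub>R A x"
  have y: "norm y = norm x" using False by (simp add: y_def)
  have "4 * Re (cinner (A x) y)
      = Re (cinner (A (x + y)) (x + y)) - Re (cinner (A (x - y)) (x - y))"
    using hermitian_Re_cinner_commute[OF A, of x y] by (simp add: A.add A.diff cinner_simps)
  also have "\<dots> \<le> c * (norm (x + y))\<^sup>2 + c * (norm (x - y))\<^sup>2"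
    using c[of "x + y"] c[of "x - y"] by linarith
  also have "\<dots> = 4 * c * (norm x)\<^sup>2"
    using parallelogram_law[of x y] by (simp add: y flip: distrib_left)
  also have "Re (cinner (A x) y) = norm x * norm (A x)"
    using False by (simp add: y_def cinner_simps cinner_self power2_eq_square)
  finally have "norm x * norm (A x) \<le> norm x * (c * norm x)"
    by (simp add: power2_eq_square algebra_simps)
  then show ?thesis using False by simp
qed

lemma positive_opI:
  assumes "hermitian A" "\<And>x. 0 \<le> Re (cinner (A x) x)"
  shows "positive_op A"
  using assms hermitian_cinner_real[OF assms(1)] hermitianD(1)[OF assms(1)] unfolding positive_op_def
  by (metis nonneg_Reals_of_real_iff)

lemma positive_op_Re_ge_0: "positive_op A \<Longrightarrow> 0 \<le> Re (cinner (A x) x)"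
  by (simp add: positive_op_def complex_nonneg_Reals_iff)

text \<open>Over complex scalars a real quadratic form forces symmetry: its imaginary part vanishes
  at \<open>x + y\<close> and at \<open>x + \<i> *\<^sub>C y\<close>, which determines
  \<open>cinner (A x) y\<close>.\<close>

lemma positive_op_hermitian:
  assumes "positive_op A"
  shows "hermitian A"
proof -
  have A: "bounded_clinear A" using assms by (simp add: positive_op_def)
  interpret A: bounded_linear A using A by (rule bounded_clinear_imp_bounded_linear)
  have Im: "Im (cinner (A x) x) = 0" for x
    using assms by (simp add: positive_op_def complex_nonneg_Reals_iff)
  have "cinner (A x) y = cnj (cinner (A y) x)" for x y
    using Im[of "x + y"] Im[of "x + \<i> *\<^sub>C y"] Im[of x] Im[of y]
    by (simp add: A.add bounded_clinear_scaleC[OF A] cinner_simps complex_eq_iff)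
  then show ?thesis unfolding hermitian_def using A by (metis cinner_commute)
qed

text \<open>The nonnegative quadratic form is minimal at \<open>y\<close>, so its derivative along
  \<open>A y\<close>, which is \<open>2 * (norm (A y))\<^sup>2\<close>, vanishes.\<close>

lemma positive_op_eq_0:
  assumes A: "positive_op A" and 0: "Re (cinner (A y) y) = 0"
  shows "A y = 0"
proof -
  have h: "hermitian A" using A by (rule positive_op_hermitian)
  interpret A: bounded_linear A by (rule hermitianD(2)[OF h])
  define z where "z = A y"
  have "0 \<le> t * (2 * Re (cinner (A y) z)) + t\<^sup>2 * Re (cinner (A z) z)" for t
    using positive_op_Re_ge_0[OF A, of "y + t *\<^sub>R z"] 0 hermitian_Re_cinner_commute[OF h, of z y]
    by (simp add: A.add A.scaleR cinner_simps power2_eq_square algebra_simps)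
  then have "2 * Re (cinner (A y) z) = 0" by (rule linear_coeff_eq_0)
  then show ?thesis by (simp add: z_def cinner_self)
qed

section \<open>The positive square root\<close>

text \<open>For \<open>\<parallel>S\<parallel> \<le> 1\<close> the iterates converge to a solution \<open>Y\<close> of \<open>Y = (S + Y\<^sup>2) / 2\<close>, that is
  \<open>(I - Y)\<^sup>2 = I - S\<close>. Their increments are dominated by those of the same iteration
  for the number \<open>S = 1\<close>, which increases to \<open>1\<close>.\<close>

primrec sqrt_iter :: "('a::real_vector \<Rightarrow> 'a) \<Rightarrow> nat \<Rightarrow> 'a \<Rightarrow> 'a" where
  "sqrt_iter S 0 = (\<lambda>x. 0)"
| "sqrt_iter S (Suc n) = (\<lambda>x. (1/2) *\<^sub>R (S x + sqrt_iter S n (sqrt_iter S n x)))"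

primrec sqrt_bound :: "nat \<Rightarrow> real" where
  "sqrt_bound 0 = 0"
| "sqrt_bound (Suc n) = (1 + (sqrt_bound n)\<^sup>2) / 2"

lemma sqrt_bound_range: "0 \<le> sqrt_bound n \<and> sqrt_bound n \<le> 1"
  by (induction n) (auto simp: power_le_one)

lemma incseq_sqrt_bound: "incseq sqrt_bound"
proof (rule incseq_SucI)
  fix n
  have "0 \<le> (1 - sqrt_bound n)\<^sup>2" by simp
  then show "sqrt_bound n \<le> sqrt_bound (Suc n)" by (simp add: power2_diff)
qed

lemma Cauchy_sqrt_bound: "Cauchy sqrt_bound"
  using incseq_convergent[OF incseq_sqrt_bound, of 1] sqrt_bound_range
  by (metis LIMSEQ_imp_Cauchy)

section \<open>Estimates and convergence of the iterates\<close>

lemma hermitian_sqrt_iter: "hermitian S \<Longrightarrow> hermitian (sqrt_iter S n)"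
proof (induction n)
  case 0
  then show ?case by (simp add: hermitian_def bounded_clinear_def)
next
  case (Suc n)
  then show ?case
    using hermitian_scaleR[OF hermitian_add[OF _ hermitian_square]] by simp
qed

lemma norm_sqrt_iter_le:
  assumes S: "\<And>x. norm (S x) \<le> norm x"
  shows "norm (sqrt_iter S n x) \<le> sqrt_bound n * norm x"
proof (induction n arbitrary: x)
  case (Suc n)
  have "norm (sqrt_iter S n (sqrt_iter S n x)) \<le> sqrt_bound n * (sqrt_bound n * norm x)"
    by (rule order_trans[OF Suc mult_left_mono[OF Suc]]) (simp add: sqrt_bound_range)
  then have "norm (S x + sqrt_iter S n (sqrt_iter S n x)) \<le> (1 + (sqrt_bound n)\<^sup>2) * norm x"
    using norm_triangle_ineq[of "S x" "sqrt_iter S n (sqrt_iter S n x)"] S[of x]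
    by (simp add: algebra_simps power2_eq_square)
  then show ?case by simp
qed simp

text \<open>For consecutive iterates with bounds \<open>y\<close> and \<open>z\<close>, the
  splitting \<open>Y Y - Z Z = Y (Y - Z) + (Y - Z) Z\<close> yields the factor
  \<open>y (y - z) + (y - z) z\<close>, exactly the scalar difference of squares.\<close>

lemma norm_sqrt_iter_Suc_diff:
  assumes h: "hermitian S" and S: "\<And>x. norm (S x) \<le> norm x"
  shows "norm (sqrt_iter S (Suc n) x - sqrt_iter S n x)
    \<le> (sqrt_bound (Suc n) - sqrt_bound n) * norm x"
proof (induction n arbitrary: x)
  case 0
  then show ?case using S[of x] by simp
next
  case (Suc n)
  define Y where "Y = sqrt_iter S (Suc n)"
  define Z where "Z = sqrt_iter S n"
  define y where "y = sqrt_bound (Suc n)"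
  define z where "z = sqrt_bound n"
  interpret Y: bounded_linear Y unfolding Y_def by (rule hermitianD(2)[OF hermitian_sqrt_iter[OF h]])
  have IH: "norm (Y x - Z x) \<le> (y - z) * norm x" for x
    using Suc unfolding Y_def Z_def y_def z_def .
  have nY: "norm (Y x) \<le> y * norm x" and nZ: "norm (Z x) \<le> z * norm x" for x
    unfolding Y_def Z_def y_def z_def by (rule norm_sqrt_iter_le[OF S])+
  have yz: "0 \<le> y" "z \<le> y"
    using sqrt_bound_range incseq_SucD[OF incseq_sqrt_bound] by (auto simp: y_def z_def)
  have "Y (Y x) - Z (Z x) = Y (Y x - Z x) + (Y (Z x) - Z (Z x))" by (simp add: Y.diff)
  also have "norm \<dots> \<le> y * norm (Y x - Z x) + (y - z) * norm (Z x)"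
    by (intro norm_triangle_le add_mono nY IH)
  also have "\<dots> \<le> y * ((y - z) * norm x) + (y - z) * (z * norm x)"
    using yz by (intro add_mono mult_left_mono IH nZ) auto
  finally have le: "norm (Y (Y x) - Z (Z x)) \<le> (y\<^sup>2 - z\<^sup>2) * norm x"
    by (simp add: algebra_simps power2_eq_square)
  have Y_diff: "sqrt_iter S (Suc (Suc n)) x - Y x = (1/2) *\<^sub>R (Y (Y x) - Z (Z x))"
  proof -
    have "sqrt_iter S (Suc (Suc n)) x = (1/2) *\<^sub>R (S x + Y (Y x))"
      and "Y x = (1/2) *\<^sub>R (S x + Z (Z x))"
      by (simp_all only: Y_def Z_def sqrt_iter.simps(2))
    then have "sqrt_iter S (Suc (Suc n)) x - Y x
        = (1/2) *\<^sub>R (S x + Y (Y x)) - (1/2) *\<^sub>R (S x + Z (Z x))"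
      by (rule arg_cong2[where f = "(-)"])
    then show ?thesis by (simp flip: scaleR_diff_right del: sqrt_iter.simps)
  qed
  have y_diff: "sqrt_bound (Suc (Suc n)) - sqrt_bound (Suc n) = (y\<^sup>2 - z\<^sup>2) / 2"
    by (simp add: y_def z_def field_simps)
  show ?case unfolding Y_def[symmetric] Y_diff y_diff using le by simp
qed

lemma norm_sqrt_iter_diff:
  assumes h: "hermitian S" and S: "\<And>x. norm (S x) \<le> norm x" and "m \<le> n"
  shows "norm (sqrt_iter S n x - sqrt_iter S m x) \<le> (sqrt_bound n - sqrt_bound m) * norm x"
  using \<open>m \<le> n\<close>
proof (induction n rule: dec_induct)
  case (step n)
  then show ?case
    using norm_triangle_ineq[of "sqrt_iter S (Suc n) x - sqrt_iter S n x"
        "sqrt_iter S n x - sqrt_iter S m x"] norm_sqrt_iter_Suc_diff[OF h S, of n x]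
    by (simp del: sqrt_iter.simps sqrt_bound.simps add: algebra_simps)
qed simp

lemma convergent_sqrt_iter:
  fixes S :: "'a::chilbert_space \<Rightarrow> 'a"
  assumes h: "hermitian S" and S: "\<And>x. norm (S x) \<le> norm x"
  shows "convergent (\<lambda>n. sqrt_iter S n x)"
proof (rule Cauchy_convergent, rule metric_CauchyI)
  fix e :: real assume e: "e > 0"
  \<comment> \<open>Adding 1 keeps the denominator positive for \<open>x = 0\<close>.\<close>
  have "e / (norm x + 1) > 0" using e by (simp add: add_nonneg_pos)
  from metric_CauchyD[OF Cauchy_sqrt_bound this] obtain N
    where N: "\<And>m n. m \<ge> N \<Longrightarrow> n \<ge> N \<Longrightarrow> dist (sqrt_bound m) (sqrt_bound n) < e / (norm x + 1)"
    by blast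
  have "dist (sqrt_iter S m x) (sqrt_iter S n x) < e" if "m \<ge> N" "n \<ge> N" for m n
  proof -
    have "dist (sqrt_iter S m x) (sqrt_iter S n x) \<le> dist (sqrt_bound m) (sqrt_bound n) * norm x"
    proof (cases "m \<le> n")
      case True
      then show ?thesis using norm_sqrt_iter_diff[OF h S True, of x] incseqD[OF incseq_sqrt_bound True]
        by (simp add: dist_norm norm_minus_commute)
    next
      case False
      then have "n \<le> m" by simp
      then show ?thesis using norm_sqrt_iter_diff[OF h S, of n m x] incseqD[OF incseq_sqrt_bound]
        by (simp add: dist_norm)
    qed
    also have "\<dots> \<le> dist (sqrt_bound m) (sqrt_bound n) * (norm x + 1)"
      by (intro mult_left_mono) auto
    also have "\<dots> < e" using N[OF that] by (simp add: pos_less_divide_eq add_nonneg_pos)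
    finally show ?thesis .
  qed
  then show "\<exists>N. \<forall>m\<ge>N. \<forall>n\<ge>N. dist (sqrt_iter S m x) (sqrt_iter S n x) < e" by blast
qed

definition sqrt_limit :: "('a::chilbert_space \<Rightarrow> 'a) \<Rightarrow> 'a \<Rightarrow> 'a"
  where "sqrt_limit S x = lim (\<lambda>n. sqrt_iter S n x)"

lemma sqrt_iter_tendsto:
  assumes "hermitian S" "\<And>x. norm (S x) \<le> norm x"
  shows "(\<lambda>n. sqrt_iter S n x) \<longlonglongrightarrow> sqrt_limit S x"
  unfolding sqrt_limit_def using convergent_sqrt_iter[OF assms] by (simp add: convergent_LIMSEQ_iff)

lemma norm_sqrt_limit_le:
  assumes h: "hermitian S" and S: "\<And>x. norm (S x) \<le> norm x"
  shows "norm (sqrt_limit S x) \<le> norm x"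
proof (rule LIMSEQ_le_const2[OF tendsto_norm[OF sqrt_iter_tendsto[OF h S]]])
  have "norm (sqrt_iter S n x) \<le> norm x" for n
    using norm_sqrt_iter_le[OF S, of n x] sqrt_bound_range[of n] mult_left_le_one_le[of "norm x"]
    by (meson norm_ge_zero order_trans)
  then show "\<exists>N. \<forall>n\<ge>N. norm (sqrt_iter S n x) \<le> norm x" by blast
qed

text \<open>Linearity and symmetry of the iterates pass to the pointwise limit, and the uniform
  bound 1 keeps it bounded.\<close>

lemma hermitian_sqrt_limit:
  assumes h: "hermitian S" and S: "\<And>x. norm (S x) \<le> norm x"
  shows "hermitian (sqrt_limit S)"
proof -
  note lim = sqrt_iter_tendsto[OF h S]
  note hn = hermitian_sqrt_iter[OF h]
  note lin = bounded_linear.linear[OF hermitianD(2)[OF hn]]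
  have "bounded_linear (sqrt_limit S)"
  proof (rule bounded_linear_intro[where K = 1])
    fix x y and r :: real
    have "(\<lambda>n. sqrt_iter S n (x + y)) \<longlonglongrightarrow> sqrt_limit S x + sqrt_limit S y"
      using tendsto_add[OF lim lim] by (simp add: linear_add lin)
    with lim show "sqrt_limit S (x + y) = sqrt_limit S x + sqrt_limit S y"
      by (rule LIMSEQ_unique)
    have "(\<lambda>n. sqrt_iter S n (r *\<^sub>R x)) \<longlonglongrightarrow> r *\<^sub>R sqrt_limit S x"
      using tendsto_scaleR[OF tendsto_const lim] by (simp add: linear_scale lin)
    with lim show "sqrt_limit S (r *\<^sub>R x) = r *\<^sub>R sqrt_limit S x"
      by (rule LIMSEQ_unique)
    show "norm (sqrt_limit S x) \<le> norm x * 1"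
      using norm_sqrt_limit_le[OF h S] by simp
  qed
  moreover have "sqrt_limit S (c *\<^sub>C x) = c *\<^sub>C sqrt_limit S x" for c x
  proof -
    have "(\<lambda>n. sqrt_iter S n (c *\<^sub>C x)) \<longlonglongrightarrow> c *\<^sub>C sqrt_limit S x"
      using bounded_linear.tendsto[OF bounded_linear_scaleC lim]
      by (simp add: bounded_clinear_scaleC[OF hermitianD(1)[OF hn]])
    with lim show ?thesis by (rule LIMSEQ_unique)
  qed
  moreover have "cinner (sqrt_limit S x) y = cinner x (sqrt_limit S y)" for x y
  proof -
    have "(\<lambda>n. cinner (sqrt_iter S n x) y) \<longlonglongrightarrow> cinner (sqrt_limit S x) y"
      by (rule bounded_linear.tendsto[OF bounded_linear_cinner_left lim])
    moreover have "(\<lambda>n. cinner (sqrt_iter S n x) y) \<longlonglongrightarrow> cinner x (sqrt_limit S y)"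
      using bounded_linear.tendsto[OF bounded_linear_cinner_right lim]
      by (simp add: hermitianD(3)[OF hn])
    ultimately show ?thesis by (rule LIMSEQ_unique)
  qed
  ultimately show ?thesis by (simp add: hermitian_def bounded_clinear_def)
qed

text \<open>The index occurs twice in \<open>sqrt_iter S n (sqrt_iter S n x)\<close>. Every iterate
  is a contraction, so its argument may first be replaced by the limit, where pointwise convergence
  applies.\<close>

lemma sqrt_limit_fixpoint:
  assumes h: "hermitian S" and S: "\<And>x. norm (S x) \<le> norm x"
  shows "sqrt_limit S x = (1/2) *\<^sub>R (S x + sqrt_limit S (sqrt_limit S x))"
proof -
  note lim = sqrt_iter_tendsto[OF h S]
  let ?Y = "sqrt_limit S x"
  have *: "norm (sqrt_iter S n (sqrt_iter S n x) - sqrt_iter S n ?Y) \<le> norm (sqrt_iter S n x - ?Y)" for n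
  proof -
    interpret bounded_linear "sqrt_iter S n" by (rule hermitianD(2)[OF hermitian_sqrt_iter[OF h]])
    have "norm (sqrt_iter S n (sqrt_iter S n x - ?Y)) \<le> 1 * norm (sqrt_iter S n x - ?Y)"
      by (rule order_trans[OF norm_sqrt_iter_le[OF S] mult_right_mono]) (auto simp: sqrt_bound_range)
    then show ?thesis by (simp add: diff)
  qed
  have "(\<lambda>n. norm (sqrt_iter S n x - ?Y)) \<longlonglongrightarrow> 0"
    using lim[of x] by (simp add: LIM_zero tendsto_norm_zero)
  then have "(\<lambda>n. sqrt_iter S n (sqrt_iter S n x) - sqrt_iter S n ?Y) \<longlonglongrightarrow> 0"
    by (rule Lim_null_comparison[rotated]) (use * in auto)
  from tendsto_add[OF this lim[of ?Y]]
  have "(\<lambda>n. sqrt_iter S n (sqrt_iter S n x)) \<longlonglongrightarrow> sqrt_limit S ?Y" by simp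
  then have "(\<lambda>n. sqrt_iter S (Suc n) x) \<longlonglongrightarrow> (1/2) *\<^sub>R (S x + sqrt_limit S ?Y)"
    by (auto intro!: tendsto_intros)
  with LIMSEQ_Suc[OF lim] show ?thesis by (rule LIMSEQ_unique)
qed

text \<open>Every iterate is a polynomial in \<open>S\<close>, which \<open>X\<close> carries to the
  same polynomial in \<open>S'\<close>; continuity of \<open>X\<close> handles the limit.\<close>

lemma sqrt_limit_intertwine:
  assumes h: "hermitian S" "hermitian S'"
    and S: "\<And>x. norm (S x) \<le> norm x" "\<And>x. norm (S' x) \<le> norm x"
    and X: "bounded_linear X" and XS: "\<And>x. X (S x) = S' (X x)"
  shows "X (sqrt_limit S x) = sqrt_limit S' (X x)"
proof -
  interpret X: bounded_linear X by fact
  have "X (sqrt_iter S n x) = sqrt_iter S' n (X x)" for n x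
    by (induction n arbitrary: x) (simp_all add: X.zero X.add X.scaleR XS)
  then have "(\<lambda>n. sqrt_iter S' n (X x)) \<longlonglongrightarrow> X (sqrt_limit S x)"
    using X.tendsto[OF sqrt_iter_tendsto[OF h(1) S(1)], of x] by simp
  then show ?thesis using LIMSEQ_unique sqrt_iter_tendsto[OF h(2) S(2)] by blast
qed

text \<open>The rescaling \<open>S = I - T / k\<close> is a contraction as soon as \<open>0 \<le> T \<le> k\<close>.\<close>

definition scaled_root :: "real \<Rightarrow> ('a::chilbert_space \<Rightarrow> 'a) \<Rightarrow> 'a \<Rightarrow> 'a"
  where "scaled_root k T x = sqrt k *\<^sub>R (x - sqrt_limit (\<lambda>x. x - (1/k) *\<^sub>R T x) x)"

text \<open>The quadratic form of the difference lies between 0 and \<open>(norm x)\<^sup>2\<close>,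
  which for a Hermitian operator bounds the norm.\<close>

lemma contraction_complement:
  assumes T: "positive_op T" and k: "k > 0" "\<And>x. norm (T x) \<le> k * norm x"
  shows "hermitian (\<lambda>x. x - (1/k) *\<^sub>R T x)" (is "hermitian ?S")
    and "norm (x - (1/k) *\<^sub>R T x) \<le> norm x"
proof -
  show h: "hermitian ?S"
    by (intro hermitian_sub hermitian_id hermitian_scaleR positive_op_hermitian[OF T])
  have "\<bar>Re (cinner (?S x) x)\<bar> \<le> 1 * (norm x)\<^sup>2" for x
  proof -
    have "Re (cinner (T x) x) \<le> norm (T x) * norm x" by (rule Re_cinner_le)
    also have "\<dots> \<le> (k * norm x) * norm x" by (intro mult_right_mono k) simp
    finally have "Re (cinner (T x) x) / k \<le> (norm x)\<^sup>2"
      using k(1) by (simp add: field_simps power2_eq_square)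
    moreover have "0 \<le> Re (cinner (T x) x) / k" using positive_op_Re_ge_0[OF T] k(1) by simp
    moreover have "Re (cinner (?S x) x) = (norm x)\<^sup>2 - Re (cinner (T x) x) / k"
      by (simp add: cinner_simps power2_norm_eq_cinner)
    ultimately show ?thesis by simp
  qed
  from hermitian_norm_le[OF h this, of x] show "norm (?S x) \<le> norm x" by simp
qed

lemma positive_op_scaled_root:
  assumes T: "positive_op T" and k: "k > 0" "\<And>x. norm (T x) \<le> k * norm x"
  shows "positive_op (scaled_root k T)"
proof (rule positive_opI)
  note S = contraction_complement[OF T k]
  let ?Y = "sqrt_limit (\<lambda>x. x - (1/k) *\<^sub>R T x)"
  show "hermitian (scaled_root k T)" unfolding scaled_root_def[abs_def]
    by (intro hermitian_scaleR hermitian_sub hermitian_id hermitian_sqrt_limit S)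
  fix x
  have "Re (cinner (?Y x) x) \<le> norm x * norm x"
    by (rule order_trans[OF Re_cinner_le mult_right_mono]) (auto intro: norm_sqrt_limit_le S)
  then show "0 \<le> Re (cinner (scaled_root k T x) x)"
    using k(1) by (simp add: scaled_root_def cinner_simps cinner_self power2_eq_square)
qed

lemma scaled_root_square:
  assumes T: "positive_op T" and k: "k > 0" "\<And>x. norm (T x) \<le> k * norm x"
  shows "scaled_root k T \<circ> scaled_root k T = T"
proof
  fix x
  note S = contraction_complement[OF T k]
  define Y where "Y = sqrt_limit (\<lambda>x. x - (1/k) *\<^sub>R T x)"
  interpret Y: bounded_linear Y
    unfolding Y_def by (rule hermitianD(2)[OF hermitian_sqrt_limit[OF S]])
  \<comment> \<open>Doubled, the fixpoint equation says that the square of \<open>I - Y\<close> is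
    \<open>T / k\<close>.\<close>
  have "2 *\<^sub>R Y x = 2 *\<^sub>R ((1/2) *\<^sub>R (x - (1/k) *\<^sub>R T x + Y (Y x)))"
    unfolding Y_def by (subst sqrt_limit_fixpoint[OF S]) auto
  then have eq: "x - 2 *\<^sub>R Y x + Y (Y x) = (1/k) *\<^sub>R T x" by simp
  have "(scaled_root k T \<circ> scaled_root k T) x = k *\<^sub>R (x - 2 *\<^sub>R Y x + Y (Y x))"
    using k(1) by (simp add: scaled_root_def Y_def[symmetric] Y.scaleR Y.diff scaleR_2
        algebra_simps)
  then show "(scaled_root k T \<circ> scaled_root k T) x = T x" using k(1) by (simp add: eq)
qed

lemma scaled_root_intertwine:
  assumes T: "positive_op T" "\<And>x. norm (T x) \<le> k * norm x"
    and T': "positive_op T'" "\<And>x. norm (T' x) \<le> k * norm x"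
    and k: "k > 0" and X: "bounded_linear X" and XT: "\<And>x. X (T x) = T' (X x)"
  shows "X (scaled_root k T x) = scaled_root k T' (X x)"
proof -
  interpret X: bounded_linear X by fact
  note S = contraction_complement[OF T(1) k T(2)] and S' = contraction_complement[OF T'(1) k T'(2)]
  show ?thesis
    by (simp add: scaled_root_def X.scaleR X.diff XT
        sqrt_limit_intertwine[OF S(1) S'(1) S(2) S'(2) X])
qed

text \<open>\<open>P\<close> commutes with its square \<open>T\<close>, hence with the constructed
  root \<open>R\<close>. For \<open>y = P x - R x\<close> this gives \<open>P y + R y = 0\<close>;
  positivity makes both terms vanish, and then \<open>y = 0\<close>.\<close>

lemma positive_root_unique:
  assumes T: "positive_op T" and k: "k > 0" "\<And>x. norm (T x) \<le> k * norm x"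
    and P: "positive_op P" "P \<circ> P = T"
  shows "P = scaled_root k T"
proof
  fix x
  define R where "R = scaled_root k T"
  have R: "positive_op R" "R \<circ> R = T"
    unfolding R_def using positive_op_scaled_root[OF T k] scaled_root_square[OF T k] by auto
  have hP: "hermitian P" and hR: "hermitian R" using P R positive_op_hermitian by auto
  interpret P: bounded_linear P by (rule hermitianD(2)[OF hP])
  interpret R: bounded_linear R by (rule hermitianD(2)[OF hR])
  have comm: "P (R x) = R (P x)" for x
    unfolding R_def
    using scaled_root_intertwine[OF T k(2) T k(2) k(1) P.bounded_linear_axioms, of x] P(2)
    by (metis comp_apply)
  define y where "y = P x - R x"
  have "P y + R y = 0"
    using fun_cong[OF P(2), of x] fun_cong[OF R(2), of x]
    by (simp add: y_def P.diff R.diff comm)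
  then have "Re (cinner (P y) y) + Re (cinner (R y) y) = 0"
    by (metis cinner_add_left cinner_zero_left plus_complex.sel(1) zero_complex.sel(1))
  then have "Re (cinner (P y) y) = 0" "Re (cinner (R y) y) = 0"
    using positive_op_Re_ge_0[OF P(1), of y] positive_op_Re_ge_0[OF R(1), of y] by linarith+
  then have "P y = 0" "R y = 0" using positive_op_eq_0 P(1) R(1) by blast+
  then have "cinner y y = 0"
    by (subst (2) y_def) (simp add: cinner_diff_right flip: hermitianD(3)[OF hP] hermitianD(3)[OF hR])
  then show "P x = scaled_root k T x" by (simp add: cinner_eq_zero_iff y_def R_def)
qed

text \<open>Existence and uniqueness make the definite description denote; every admissible scale
  \<open>k\<close> yields the same root.\<close>

lemma sqrt_op_eq_scaled_root:
  assumes T: "positive_op T" and k: "k > 0" "\<And>x. norm (T x) \<le> k * norm x"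
  shows "sqrt_op T = scaled_root k T"
  unfolding sqrt_op_def
proof (rule the_equality)
  show "positive_op (scaled_root k T) \<and> scaled_root k T \<circ> scaled_root k T = T"
    using positive_op_scaled_root[OF T k] scaled_root_square[OF T k] by blast
qed (use positive_root_unique[OF T k] in blast)

lemma positive_op_bound:
  assumes "positive_op T"
  obtains k where "k > 0" "\<And>x. norm (T x) \<le> k * norm x"
proof -
  from bounded_linear.pos_bounded[OF hermitianD(2)[OF positive_op_hermitian[OF assms]]]
  obtain k where "k > 0" "\<forall>x. norm (T x) \<le> norm x * k" by blast
  then show thesis using that[of k] by (simp add: mult.commute)
qed

section \<open>Scale-free properties of the square root\<close>

lemma sqrt_op:
  assumes "positive_op T"
  shows "positive_op (sqrt_op T)" "sqrt_op T (sqrt_op T x) = T x"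
proof -
  obtain k where k: "k > 0" "\<And>x. norm (T x) \<le> k * norm x"
    using positive_op_bound[OF assms] by blast
  show "positive_op (sqrt_op T)"
    unfolding sqrt_op_eq_scaled_root[OF assms k] by (rule positive_op_scaled_root[OF assms k])
  show "sqrt_op T (sqrt_op T x) = T x"
    unfolding sqrt_op_eq_scaled_root[OF assms k]
    using fun_cong[OF scaled_root_square[OF assms k], of x] by simp
qed

lemma sqrt_op_unique:
  assumes "positive_op T" "positive_op P" "P \<circ> P = T"
  shows "sqrt_op T = P"
proof -
  obtain k where k: "k > 0" "\<And>x. norm (T x) \<le> k * norm x"
    using positive_op_bound[OF assms(1)] by blast
  show ?thesis
    using sqrt_op_eq_scaled_root[OF assms(1) k] positive_root_unique[OF assms(1) k assms(2,3)] by simp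
qed

lemma sqrt_op_intertwine:
  assumes T: "positive_op T" "positive_op T'"
    and X: "bounded_linear X" "\<And>x. X (T x) = T' (X x)"
  shows "X (sqrt_op T x) = sqrt_op T' (X x)"
proof -
  obtain k where k: "k > 0" "\<And>x. norm (T x) \<le> k * norm x"
    using positive_op_bound[OF T(1)] by blast
  obtain k' where k': "k' > 0" "\<And>x. norm (T' x) \<le> k' * norm x"
    using positive_op_bound[OF T(2)] by blast
  \<comment> \<open>A common scale for \<open>T\<close> and \<open>T'\<close>, so that
    \<open>X\<close> also intertwines the rescaled operators.\<close>
  define m where "m = max k k'"
  have m: "m > 0" "\<And>x. norm (T x) \<le> m * norm x" "\<And>x. norm (T' x) \<le> m * norm x"
    using k(1) order_trans[OF k(2) mult_right_mono] order_trans[OF k'(2) mult_right_mono]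
    by (auto simp: m_def)
  have "sqrt_op T = scaled_root m T" by (rule sqrt_op_eq_scaled_root[OF T(1) m(1) m(2)])
  moreover have "sqrt_op T' = scaled_root m T'" by (rule sqrt_op_eq_scaled_root[OF T(2) m(1) m(3)])
  moreover have "X (scaled_root m T x) = scaled_root m T' (X x)"
    by (rule scaled_root_intertwine[OF T(1) m(2) T(2) m(3) m(1) X])
  ultimately show ?thesis by simp
qed

section \<open>The modulus of a Hermitian operator\<close>

lemma positive_op_square: "hermitian A \<Longrightarrow> positive_op (A \<circ> A)"
  by (rule positive_opI[OF hermitian_square])
    (simp_all add: hermitianD(3)[of A "A _"] cinner_self)

lemma abs_op_hermitian: "hermitian A \<Longrightarrow> abs_op A = sqrt_op (A \<circ> A)"
  by (simp add: abs_op_def hermitian_cadjoint)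

text \<open>Put \<open>M = R + A\<close> and \<open>N = |M|\<close>. Then \<open>M\<^sup>2 = 2 R M\<close>, so \<open>M\<close> intertwines \<open>M\<^sup>2\<close> with \<open>(2 R)\<^sup>2\<close>
  and hence \<open>N\<close> with \<open>2 R\<close>. Thus \<open>M N = 2 R M = M\<^sup>2\<close>, which gives \<open>(N - M)\<^sup>2 = 0\<close>.\<close>

lemma positive_op_add_of_square_eq:
  fixes A R :: "'a::chilbert_space \<Rightarrow> 'a"
  assumes A: "hermitian A" and R: "positive_op R"
    and sq: "\<And>x. R (R x) = A (A x)" and comm: "\<And>x. A (R x) = R (A x)"
  shows "positive_op (\<lambda>x. R x + A x)"
proof -
  have hR: "hermitian R" using R by (rule positive_op_hermitian)
  interpret A: bounded_linear A by (rule hermitianD(2)[OF A])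
  interpret R: bounded_linear R by (rule hermitianD(2)[OF hR])
  define M where "M = (\<lambda>x. R x + A x)"
  define D where "D = (\<lambda>x. 2 *\<^sub>R R x)"
  have hM: "hermitian M" unfolding M_def by (rule hermitian_add[OF hR A])
  interpret M: bounded_linear M by (rule hermitianD(2)[OF hM])
  have D: "positive_op D"
    unfolding D_def using positive_op_Re_ge_0[OF R]
    by (intro positive_opI hermitian_scaleR hR) (simp add: cinner_simps)
  \<comment> \<open>Both identities use that \<open>A\<close> commutes with \<open>R\<close>; the
    first also uses that their squares agree.\<close>
  have MM: "M (M x) = D (M x)" and MD: "M (D x) = D (M x)" for x
    by (simp_all add: M_def D_def R.add A.add R.scaleR A.scaleR comm sq scaleR_2)
  define N where "N = sqrt_op (M \<circ> M)"
  have N: "positive_op N" "\<And>x. N (N x) = M (M x)"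
    unfolding N_def using sqrt_op[OF positive_op_square[OF hM]] by auto
  have hN: "hermitian N" by (rule positive_op_hermitian[OF N(1)])
  interpret N: bounded_linear N by (rule hermitianD(2)[OF hN])
  have sD: "sqrt_op (D \<circ> D) = D"
    by (rule sqrt_op_unique[OF positive_op_square[OF positive_op_hermitian[OF D]] D]) simp
  \<comment> \<open>\<open>M\<close> intertwines the squares of \<open>M\<close> and
    \<open>D\<close>, whose positive roots are \<open>N\<close> and \<open>D\<close>.\<close>
  have MN: "M (N x) = D (M x)" for x
    unfolding N_def
    by (subst sqrt_op_intertwine[OF positive_op_square[OF hM]
          positive_op_square[OF positive_op_hermitian[OF D]] M.bounded_linear_axioms])
      (simp_all add: MM MD sD)
  have NM: "M (N x) = N (M x)" for x
    unfolding N_def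
    by (rule sqrt_op_intertwine[OF positive_op_square[OF hM] positive_op_square[OF hM]
          M.bounded_linear_axioms]) simp
  have "N x = M x" for x
  proof -
    let ?v = "N x - M x"
    have "N ?v - M ?v = 0"
      by (simp add: N.diff M.diff N(2) MN MM flip: NM)
    \<comment> \<open>Symmetry of \<open>N - M\<close> turns the vanishing square into a vanishing
      norm.\<close>
    moreover have "cinner ?v ?v = cinner x (N ?v - M ?v)"
      by (simp add: cinner_diff_left cinner_diff_right hermitianD(3)[OF hN] hermitianD(3)[OF hM]
          N.diff M.diff)
    ultimately have "cinner ?v ?v = 0" by simp
    then show ?thesis by (simp add: cinner_eq_zero_iff)
  qed
  then have "N = M" by blast
  then show ?thesis using N(1) by (simp add: M_def)
qed

lemma positive_op_abs_op: "hermitian A \<Longrightarrow> positive_op (abs_op A)"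
  by (simp add: abs_op_hermitian sqrt_op positive_op_square)

text \<open>\<open>A\<close> and its negative have the same square, so
  \<open>positive_op_add_of_square_eq\<close> makes both \<open>R + A\<close> and
  \<open>R - A\<close> positive for \<open>R = abs_op A\<close>.\<close>

lemma abs_cinner_le_abs_op:
  assumes A: "hermitian A"
  shows "\<bar>Re (cinner (A x) x)\<bar> \<le> Re (cinner (abs_op A x) x)"
proof -
  define R where "R = abs_op A"
  have R: "positive_op R" unfolding R_def by (rule positive_op_abs_op[OF A])
  have sq: "R (R x) = A (A x)" for x
    unfolding R_def abs_op_hermitian[OF A] by (simp add: sqrt_op(2)[OF positive_op_square[OF A]])
  have comm: "A (R x) = R (A x)" for x
    unfolding R_def abs_op_hermitian[OF A]
    by (rule sqrt_op_intertwine[OF positive_op_square[OF A] positive_op_square[OF A] hermitianD(2)[OF A]])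
      simp
  interpret A: bounded_linear A by (rule hermitianD(2)[OF A])
  interpret R: bounded_linear R by (rule hermitianD(2)[OF positive_op_hermitian[OF R]])
  have "hermitian (\<lambda>x. - A x)" using hermitian_scaleR[OF A, of "-1"] by simp
  from positive_op_add_of_square_eq[OF this R]
  have "positive_op (\<lambda>x. R x + - A x)" by (simp add: sq comm A.neg R.neg)
  moreover have "positive_op (\<lambda>x. R x + A x)"
    by (rule positive_op_add_of_square_eq[OF A R sq comm])
  ultimately show ?thesis
    using positive_op_Re_ge_0[of "\<lambda>x. R x + - A x" x] positive_op_Re_ge_0[of "\<lambda>x. R x + A x" x]
    by (simp add: cinner_simps R_def abs_le_iff)
qed

section \<open>Cartesian decomposition and numerical radius\<close>

lemma hermitian_Re_op:
  assumes A: "bounded_clinear A"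
  shows "hermitian (Re_op A)"
  unfolding hermitian_def
proof (intro conjI allI)
  show "bounded_clinear (Re_op A)" unfolding Re_op_def
    by (intro bounded_clinear_const_scaleC bounded_clinear_add A bounded_clinear_cadjoint)
  fix x y
  show "cinner (Re_op A x) y = cinner x (Re_op A y)"
    using cinner_cadjoint[OF A, of x y] cinner_cadjoint[OF A, of y x]
      cinner_commute[of "cadjoint A x" y] cinner_commute[of x "A y"]
    by (simp add: Re_op_def cinner_simps)
qed

lemma hermitian_Im_op:
  assumes A: "bounded_clinear A"
  shows "hermitian (Im_op A)"
  unfolding hermitian_def
proof (intro conjI allI)
  show "bounded_clinear (Im_op A)" unfolding Im_op_def
    by (intro bounded_clinear_const_scaleC bounded_clinear_sub A bounded_clinear_cadjoint)
  fix x y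
  show "cinner (Im_op A x) y = cinner x (Im_op A y)"
    using cinner_cadjoint[OF A, of x y] cinner_cadjoint[OF A, of y x]
      cinner_commute[of "cadjoint A x" y] cinner_commute[of x "A y"]
    by (simp add: Im_op_def cinner_simps algebra_simps)
qed

lemma Re_Im_op_add: "A x = Re_op A x + \<i> *\<^sub>C Im_op A x"
proof -
  have "Re_op A x + \<i> *\<^sub>C Im_op A x = (1/2) *\<^sub>R (A x + cadjoint A x) + (1/2) *\<^sub>R (A x - cadjoint A x)"
    by (simp add: Re_op_def Im_op_def scaleC_scaleC scaleR_scaleC)
  also have "\<dots> = A x" by (simp flip: scaleR_add_right scaleR_2)
  finally show ?thesis by simp
qed

lemma Re_Im_op_diff: "cadjoint A x = Re_op A x - \<i> *\<^sub>C Im_op A x"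
proof -
  have "Re_op A x - \<i> *\<^sub>C Im_op A x = (1/2) *\<^sub>R (A x + cadjoint A x) - (1/2) *\<^sub>R (A x - cadjoint A x)"
    by (simp add: Re_op_def Im_op_def scaleC_scaleC scaleR_scaleC)
  also have "\<dots> = cadjoint A x" by (simp flip: scaleR_diff_right scaleR_2)
  finally show ?thesis by simp
qed

text \<open>The forms of \<open>B\<close> and \<open>C\<close> are real, so they are the real and
  imaginary parts of the combined form.\<close>

lemma cmod_cinner_cartesian:
  assumes "hermitian B" "hermitian C"
  shows "(cmod (cinner (B x + \<i> *\<^sub>C C x) x))\<^sup>2 = (Re (cinner (B x) x))\<^sup>2 + (Re (cinner (C x) x))\<^sup>2"
proof -
  have "Im (cinner (B x) x) = 0" "Im (cinner (C x) x) = 0"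
    using hermitian_cinner_real[OF assms(1), of x] hermitian_cinner_real[OF assms(2), of x]
    by (metis Im_complex_of_real)+
  then show ?thesis by (simp add: cinner_simps cmod_power2)
qed

section \<open>Bounds for and by the numerical radius\<close>

lemma bdd_above_numerical_range:
  assumes "bounded_clinear A"
  shows "bdd_above ((\<lambda>x. cmod (cinner (A x) x)) ` {x. norm x = 1})"
proof (rule bdd_aboveI2)
  fix x assume "x \<in> {x :: 'a. norm x = 1}"
  then show "cmod (cinner (A x) x) \<le> onorm A"
    using norm_cinner_le[of "A x" x] onorm[OF bounded_clinear_imp_bounded_linear[OF assms], of x] by simp
qed

text \<open>By homogeneity it suffices to treat unit vectors. On the zero space only
  \<open>x = 0\<close> occurs, and the unspecified supremum is multiplied by 0.\<close>

lemma cinner_le_numerical_radius: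
  fixes A :: "'a::chilbert_space \<Rightarrow> 'a"
  assumes A: "bounded_clinear A"
  shows "cmod (cinner (A x) x) \<le> numerical_radius A * (norm x)\<^sup>2"
proof (cases "x = 0")
  case False
  interpret A: bounded_linear A by (rule bounded_clinear_imp_bounded_linear[OF A])
  define u where "u = (1 / norm x) *\<^sub>R x"
  have u: "norm u = 1" "x = norm x *\<^sub>R u" using False by (auto simp: u_def)
  have "cmod (cinner (A u) u) \<le> numerical_radius A"
    unfolding numerical_radius_def using u(1)
    by (intro cSUP_upper bdd_above_numerical_range A) simp
  moreover have "cmod (cinner (A x) x) = cmod (cinner (A u) u) * (norm x)\<^sup>2"
    by (subst (1 2) u(2)) (simp add: A.scaleR cinner_simps norm_mult power2_eq_square)
  ultimately show ?thesis by (simp add: mult_right_mono)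
qed simp

text \<open>Without unit vectors both sides are the same unspecified \<open>Sup {}\<close>.
  Otherwise a unit vector shows the left radius to be nonnegative, so squaring preserves the
  order.\<close>

lemma numerical_radius_power2_mono:
  fixes A B :: "'a::chilbert_space \<Rightarrow> 'a"
  assumes B: "bounded_clinear B"
    and le: "\<And>x. cmod (cinner (A x) x) \<le> cmod (cinner (B x) x)"
  shows "(numerical_radius A)\<^sup>2 \<le> (numerical_radius B)\<^sup>2"
proof (cases "\<exists>x :: 'a. norm x = 1")
  case True
  then obtain e :: 'a where e: "norm e = 1" by blast
  have bdd: "bdd_above ((\<lambda>x. cmod (cinner (B x) x)) ` {x. norm x = 1})"
    by (rule bdd_above_numerical_range[OF B])
  have "bdd_above ((\<lambda>x. cmod (cinner (A x) x)) ` {x. norm x = 1})"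
    using bdd le unfolding bdd_above_def by (auto intro: order_trans)
  then have "cmod (cinner (A e) e) \<le> numerical_radius A"
    unfolding numerical_radius_def using e by (intro cSUP_upper) auto
  then have "0 \<le> numerical_radius A" using norm_ge_zero order_trans by blast
  moreover have "numerical_radius A \<le> numerical_radius B"
    unfolding numerical_radius_def using e le by (intro cSUP_mono bdd) auto
  ultimately show ?thesis by (simp add: power_mono)
qed (simp add: numerical_radius_def)

text \<open>Meant for \<open>D\<close> the sum or the difference of \<open>B\<close> and
  \<open>C\<close>; the norm of \<open>D\<close> is read off from its quadratic form.\<close>

lemma hermitian_onorm_le_numerical_radius:
  assumes B: "hermitian B" and C: "hermitian C" and D: "hermitian D"
    and A: "bounded_clinear A" "\<And>x. A x = B x + \<i> *\<^sub>C C x"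
    and D_le: "\<And>x. (Re (cinner (D x) x))\<^sup>2
      \<le> 2 * ((Re (cinner (B x) x))\<^sup>2 + (Re (cinner (C x) x))\<^sup>2)"
  shows "(onorm D)\<^sup>2 \<le> 2 * (numerical_radius A)\<^sup>2"
proof -
  \<comment> \<open>The absolute value keeps the bound nonnegative on the zero space too, where the
    radius has unknown sign.\<close>
  have w: "\<bar>Re (cinner (D x) x)\<bar> \<le> sqrt 2 * \<bar>numerical_radius A\<bar> * (norm x)\<^sup>2" for x
  proof (rule power2_le_imp_le)
    have "(Re (cinner (D x) x))\<^sup>2 \<le> 2 * (cmod (cinner (A x) x))\<^sup>2"
      using D_le[of x] by (simp add: A(2) cmod_cinner_cartesian[OF B C])
    also have "\<dots> \<le> 2 * (numerical_radius A * (norm x)\<^sup>2)\<^sup>2"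
      using power_mono[OF cinner_le_numerical_radius[OF A(1)]] by simp
    finally show "\<bar>Re (cinner (D x) x)\<bar>\<^sup>2 \<le> (sqrt 2 * \<bar>numerical_radius A\<bar> * (norm x)\<^sup>2)\<^sup>2"
      by (simp add: power_mult_distrib)
  qed simp
  have "onorm D \<le> sqrt 2 * \<bar>numerical_radius A\<bar>"
    by (rule onorm_bound[OF _ hermitian_norm_le[OF D w]]) simp
  from power_mono[OF this onorm_pos_le[OF hermitianD(2)[OF D]], of 2]
  show ?thesis by (simp add: power_mult_distrib)
qed

text \<open>\<open>(p + q) * \<bar>p - q\<bar>\<close> is the larger minus the smaller of the two
  squares, that is, twice the larger minus their sum; the larger is at most
  \<open>2 * w\<^sup>2\<close>.\<close>

lemma quarter_sum_squares_bound:
  fixes m p q w :: real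
  assumes "2 * m \<le> p + q" "p\<^sup>2 \<le> 2 * w\<^sup>2" "q\<^sup>2 \<le> 2 * w\<^sup>2"
  shows "1/4 * (p\<^sup>2 + q\<^sup>2) + 1/2 * m * \<bar>p - q\<bar> \<le> w\<^sup>2"
proof -
  have "2 * m * \<bar>p - q\<bar> \<le> (p + q) * \<bar>p - q\<bar>"
    by (intro mult_right_mono assms) simp
  moreover have "(p + q) * \<bar>p - q\<bar> \<le> 4 * w\<^sup>2 - p\<^sup>2 - q\<^sup>2"
    using assms by (cases "p \<ge> q") (simp_all add: algebra_simps power2_eq_square)
  ultimately show ?thesis by (simp add: algebra_simps)
qed

text \<open>With \<open>B\<close>, \<open>C\<close> the real and imaginary parts, both sides are
  \<open>2 (B\<^sup>2 + C\<^sup>2)\<close>: the mixed terms \<open>i (B C - C B)\<close> cancel on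
  the left, and \<open>B C + C B\<close> on the right.\<close>

lemma adjoint_products_cartesian:
  fixes A :: "'a::chilbert_space \<Rightarrow> 'a"
  assumes A: "bounded_clinear A"
  defines "P \<equiv> \<lambda>x. Re_op A x + Im_op A x" and "Q \<equiv> \<lambda>x. Re_op A x - Im_op A x"
  shows "cadjoint A (A x) + A (cadjoint A x) = P (P x) + Q (Q x)"
proof -
  note B = hermitian_Re_op[OF A] and C = hermitian_Im_op[OF A]
  interpret B: bounded_linear "Re_op A" by (rule hermitianD(2)[OF B])
  interpret C: bounded_linear "Im_op A" by (rule hermitianD(2)[OF C])
  note BC = bounded_clinear_scaleC[OF hermitianD(1)[OF B]] bounded_clinear_scaleC[OF hermitianD(1)[OF C]]
  have "cadjoint A (A x) + A (cadjoint A x)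
      = (Re_op A (Re_op A x) + Im_op A (Im_op A x)) + (Re_op A (Re_op A x) + Im_op A (Im_op A x))"
    unfolding Re_Im_op_diff[of A "A x"] Re_Im_op_add[of A "cadjoint A x"]
    unfolding Re_Im_op_diff[of A x]
    by (subst (1 2) Re_Im_op_add[of A x])
      (simp add: B.add B.diff C.add C.diff BC scaleC_add_right scaleC_diff_right scaleC_scaleC scaleC_minus_one)
  then show ?thesis by (simp add: P_def Q_def B.add B.diff C.add C.diff)
qed

lemma onorm_sum_squares_le:
  assumes P: "bounded_linear P" and Q: "bounded_linear Q"
  shows "onorm (\<lambda>x. P (P x) + Q (Q x)) \<le> (onorm P)\<^sup>2 + (onorm Q)\<^sup>2"
proof -
  have "onorm (\<lambda>x. P (P x) + Q (Q x)) \<le> onorm (P \<circ> P) + onorm (Q \<circ> Q)"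
    using onorm_triangle[of "P \<circ> P" "Q \<circ> Q"] P Q
    by (simp add: o_def bounded_linear_compose)
  then show ?thesis using onorm_compose[OF P P] onorm_compose[OF Q Q] by (simp add: power2_eq_square)
qed

theorem corollary2p5:
  fixes A :: "'a::chilbert_space \<Rightarrow> 'a"
  assumes "bounded_clinear A"
  shows "1 / 4 * onorm (\<lambda>x. cadjoint A (A x) + A (cadjoint A x))
      + 1 / 2 * max (onorm (Re_op A)) (onorm (Im_op A))
        * \<bar>onorm (\<lambda>x. Re_op A x + Im_op A x) - onorm (\<lambda>x. Re_op A x - Im_op A x)\<bar>
      \<le> (numerical_radius A)\<^sup>2
    \<and> (numerical_radius A)\<^sup>2
      \<le> (numerical_radius (\<lambda>x. abs_op (Re_op A) x + \<i> *\<^sub>C abs_op (Im_op A) x))\<^sup>2"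
proof (rule conjI)
  note B = hermitian_Re_op[OF assms] and C = hermitian_Im_op[OF assms]
  define P where "P = (\<lambda>x. Re_op A x + Im_op A x)"
  define Q where "Q = (\<lambda>x. Re_op A x - Im_op A x)"
  have hP: "hermitian P" and hQ: "hermitian Q"
    unfolding P_def Q_def using B C by (auto intro: hermitian_add hermitian_sub)
  note P = hermitianD(2)[OF hP] and Q = hermitianD(2)[OF hQ]
  \<comment> \<open>For the forms \<open>b + c\<close> and \<open>b - c\<close> of \<open>P\<close>
    and \<open>Q\<close>, this is the last hypothesis of
    \<open>hermitian_onorm_le_numerical_radius\<close>.\<close>
  have sq: "(r + s)\<^sup>2 \<le> 2 * r\<^sup>2 + 2 * s\<^sup>2" "(r - s)\<^sup>2 \<le> 2 * r\<^sup>2 + 2 * s\<^sup>2" for r s :: real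
    using zero_le_power2[of "r - s"] zero_le_power2[of "r + s"]
    by (simp_all add: power2_sum power2_diff)
  have p: "(onorm P)\<^sup>2 \<le> 2 * (numerical_radius A)\<^sup>2" and q: "(onorm Q)\<^sup>2 \<le> 2 * (numerical_radius A)\<^sup>2"
    by (rule hermitian_onorm_le_numerical_radius[OF B C _ assms Re_Im_op_add];
        simp add: hP hQ; simp add: P_def Q_def cinner_simps sq)+
  \<comment> \<open>Writing both parts through \<open>P\<close> and \<open>Q\<close> bounds their
    norms by the mean of \<open>onorm P\<close> and \<open>onorm Q\<close>.\<close>
  have Re_op: "Re_op A = (\<lambda>x. (1/2) *\<^sub>R (P x + Q x))"
    and Im_op: "Im_op A = (\<lambda>x. (1/2) *\<^sub>R (P x - Q x))"
    by (auto simp: P_def Q_def simp flip: scaleR_2)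
  have "onorm (Re_op A) \<le> (onorm P + onorm Q) / 2"
    unfolding Re_op using onorm_scaleR[OF bounded_linear_add[OF P Q], of "1/2"] onorm_triangle[OF P Q] by simp
  moreover have "onorm (Im_op A) \<le> (onorm P + onorm Q) / 2"
    unfolding Im_op using onorm_scaleR[OF bounded_linear_sub[OF P Q], of "1/2"]
      onorm_triangle[OF P bounded_linear_minus[OF Q]] by (simp add: onorm_neg)
  ultimately have "2 * max (onorm (Re_op A)) (onorm (Im_op A)) \<le> onorm P + onorm Q" by simp
  note bound = quarter_sum_squares_bound[OF this p q]
  have PQ: "(\<lambda>x. cadjoint A (A x) + A (cadjoint A x)) = (\<lambda>x. P (P x) + Q (Q x))"
    using adjoint_products_cartesian[OF assms] by (simp add: P_def Q_def)
  show "1 / 4 * onorm (\<lambda>x. cadjoint A (A x) + A (cadjoint A x))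
      + 1 / 2 * max (onorm (Re_op A)) (onorm (Im_op A))
        * \<bar>onorm (\<lambda>x. Re_op A x + Im_op A x) - onorm (\<lambda>x. Re_op A x - Im_op A x)\<bar>
      \<le> (numerical_radius A)\<^sup>2"
    unfolding PQ P_def[symmetric] Q_def[symmetric]
    by (rule order_trans[OF add_right_mono[OF mult_left_mono[OF onorm_sum_squares_le[OF P Q]]] bound]) simp
next
  note B = hermitian_Re_op[OF assms] and C = hermitian_Im_op[OF assms]
  note B' = positive_op_hermitian[OF positive_op_abs_op[OF B]]
    and C' = positive_op_hermitian[OF positive_op_abs_op[OF C]]
  show "(numerical_radius A)\<^sup>2
      \<le> (numerical_radius (\<lambda>x. abs_op (Re_op A) x + \<i> *\<^sub>C abs_op (Im_op A) x))\<^sup>2"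
  proof (rule numerical_radius_power2_mono)
    show "bounded_clinear (\<lambda>x. abs_op (Re_op A) x + \<i> *\<^sub>C abs_op (Im_op A) x)"
      by (intro bounded_clinear_add bounded_clinear_const_scaleC hermitianD(1)[OF B'] hermitianD(1)[OF C'])
    fix x
    \<comment> \<open>The comparison is made after squaring, where the Cartesian formula splits each
      side into a sum of two squares.\<close>
    have "(cmod (cinner (A x) x))\<^sup>2
        \<le> (cmod (cinner (abs_op (Re_op A) x + \<i> *\<^sub>C abs_op (Im_op A) x) x))\<^sup>2"
      unfolding cmod_cinner_cartesian[OF B' C'] Re_Im_op_add[of A x] cmod_cinner_cartesian[OF B C]
      using abs_cinner_le_abs_op[OF B, of x] abs_cinner_le_abs_op[OF C, of x]
      by (intro add_mono) (simp_all flip: abs_le_square_iff)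
    then show "cmod (cinner (A x) x)
        \<le> cmod (cinner (abs_op (Re_op A) x + \<i> *\<^sub>C abs_op (Im_op A) x) x)"
      by (rule power2_le_imp_le) simp
  qed
qed

end
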